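(* Let $M$ be a compact finite-dimensional manifold with normalized Lebesgue measure $m$, and let $f\colon M\to M$ be continuous. The set $\mathcal{O}$ of all observable measures for $f$ is the minimal compact subset of $\mathcal{P}$ whose basin of attraction has total Lebesgue measure; that is, $\mathcal{O}$ is compact, $m(B(\mathcal{O}))=1$, and $\mathcal{O}\subset\mathcal{K}$ for every compact $\mathcal{K}\subset\mathcal{P}$ with $m(B(\mathcal{K}))=1$.
   Context: $M$ is a compact finite-dimensional (Riemannian) manifold and $m$ is the Lebesgue (Riemannian volume) measure on $M$ normalized so that $m(M)=1$; $m$ is not assumed to be $f$-invariant. $\mathcal{P}$ is the set of all Borel probability measures on $M$, with the weak$^*$ topology, and $\mathrm{dist}^*$ is a fixed metric on $\mathcal{P}$ inducing this topology. For $x\in M$, $p\omega(x)\subset\mathcal{P}$ is the set of all weak$^*$ limits of convergent subsequences of $\left\{\frac1n\sum_{j=0}^{n-1}\delta_{f^j(x)}\right\}_{n\ge 1}$, where $\delta_y$ is the Dirac measure at $y$. A measure $\mu\in\mathcal{P}$ is observable for $f$ if for every $\varepsilon>0$ the set $\{x\in M:\mathrm{dist}^*(p\omega(x),\mu)<\varepsilon\}$ has positive Lebesgue measure (here $\mathrm{dist}^*(p\omega(x),\mu)$ is the minimum distance from $\mu$ to points of $p\omega(x)$). The basin of attraction of a compact set $\mathcal{K}\subset\mathcal{P}$ is $B(\mathcal{K})=\{x\in M: p\omega(x)\subset\mathcal{K}\}$ (possibly empty). *)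

theory Defs
  imports "HOL-Probability.Probability"
begin

section \<open>Smooth manifolds with a Riemannian metric\<close>

text \<open>The manifold is the whole of a Hausdorff, second countable type; charts take values in
  \<open>real ^ 'n\<close>, so its dimension is \<open>CARD('n)\<close>. A chart is a pair \<open>(U, \<phi>)\<close>; the values of \<open>\<phi>\<close>
  outside \<open>U\<close> are irrelevant.\<close>

type_synonym ('a, 'n) chart = "'a set \<times> ('a \<Rightarrow> real ^ 'n)"

text \<open>On an open set \<open>S\<close>, \<open>k_times_cont_diff_on S k\<close> is the class \<open>C\<^sup>k\<close>.\<close>

primrec k_times_cont_diff_on ::
    "'v::real_normed_vector set \<Rightarrow> nat \<Rightarrow> ('v \<Rightarrow> 'w::real_normed_vector) \<Rightarrow> bool" where
  "k_times_cont_diff_on S 0 h \<longleftrightarrow> continuous_on S h"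
| "k_times_cont_diff_on S (Suc k) h \<longleftrightarrow>
     (\<forall>x\<in>S. h differentiable (at x)) \<and>
     (\<forall>v. k_times_cont_diff_on S k (\<lambda>x. frechet_derivative h (at x) v))"

definition smooth_on :: "'v::real_normed_vector set \<Rightarrow> ('v \<Rightarrow> 'w::real_normed_vector) \<Rightarrow> bool" where
  "smooth_on S h \<longleftrightarrow> (\<forall>k. k_times_cont_diff_on S k h)"

definition is_chart :: "('a::topological_space, 'n::finite) chart \<Rightarrow> bool" where
  "is_chart c \<longleftrightarrow> (case c of (U, \<phi>) \<Rightarrow>
     open U \<and> open (\<phi> ` U) \<and> homeomorphism U (\<phi> ` U) \<phi> (inv_into U \<phi>))"

text \<open>The coordinate change \<open>\<psi> \<circ> \<phi>\<^sup>-\<^sup>1\<close>, meaningful on \<open>\<phi> ` (U \<inter> V)\<close>.\<close>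

definition transition ::
    "('a, 'n::finite) chart \<Rightarrow> ('a, 'n) chart \<Rightarrow> real ^ 'n \<Rightarrow> real ^ 'n" where
  "transition c c' = snd c' \<circ> inv_into (fst c) (snd c)"

definition smooth_atlas :: "('a::topological_space, 'n::finite) chart set \<Rightarrow> bool" where
  "smooth_atlas \<A> \<longleftrightarrow>
     (\<forall>c\<in>\<A>. is_chart c) \<and>
     (\<Union>c\<in>\<A>. fst c) = UNIV \<and>
     (\<forall>c\<in>\<A>. \<forall>c'\<in>\<A>. smooth_on (snd c ` (fst c \<inter> fst c')) (transition c c'))"

text \<open>A Riemannian metric is given by its coefficient matrices \<open>g c\<close> in the charts \<open>c\<close> of the
  atlas, which transform as a symmetric covariant 2-tensor.\<close>

definition riemannian_metric ::
    "('a::topological_space, 'n::finite) chart set \<Rightarrow>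
      (('a, 'n) chart \<Rightarrow> real ^ 'n \<Rightarrow> real ^ 'n ^ 'n) \<Rightarrow> bool" where
  "riemannian_metric \<A> g \<longleftrightarrow>
     (\<forall>(U, \<phi>)\<in>\<A>. smooth_on (\<phi> ` U) (g (U, \<phi>)) \<and>
        (\<forall>x\<in>\<phi> ` U. transpose (g (U, \<phi>) x) = g (U, \<phi>) x \<and>
                    (\<forall>v. v \<noteq> 0 \<longrightarrow> v \<bullet> (g (U, \<phi>) x *v v) > 0))) \<and>
     (\<forall>c\<in>\<A>. \<forall>c'\<in>\<A>. \<forall>x\<in>snd c ` (fst c \<inter> fst c').
        g c x = transpose (jacobian (transition c c') (at x)) ** g c' (transition c c' x)
                  ** jacobian (transition c c') (at x))"

text \<open>The Riemannian volume is the Borel measure with density \<open>sqrt (det g)\<close> in every chart.\<close>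

definition riemannian_volume ::
    "('a::topological_space, 'n::finite) chart set \<Rightarrow>
      (('a, 'n) chart \<Rightarrow> real ^ 'n \<Rightarrow> real ^ 'n ^ 'n) \<Rightarrow> 'a measure \<Rightarrow> bool" where
  "riemannian_volume \<A> g vol \<longleftrightarrow>
     sets vol = sets borel \<and>
     (\<forall>(U, \<phi>)\<in>\<A>. \<forall>B\<in>sets borel. B \<subseteq> U \<longrightarrow>
        emeasure vol B = (\<integral>\<^sup>+ x\<in>\<phi> ` B. ennreal (sqrt (det (g (U, \<phi>) x))) \<partial>lborel))"

definition normalized_volume ::
    "('a::topological_space, 'n::finite) chart set \<Rightarrow>
      (('a, 'n) chart \<Rightarrow> real ^ 'n \<Rightarrow> real ^ 'n ^ 'n) \<Rightarrow> 'a measure \<Rightarrow> bool" where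
  "normalized_volume \<A> g m \<longleftrightarrow>
     emeasure m UNIV = 1 \<and>
     (\<exists>vol. \<exists>r>0::real. riemannian_volume \<A> g vol \<and> m = scale_measure (ennreal r) vol)"

section \<open>Borel probability measures with the weak* topology\<close>

definition borel_probabilities :: "'a::topological_space measure set" where
  "borel_probabilities = {\<mu>. sets \<mu> = sets borel \<and> prob_space \<mu>}"

text \<open>The coarsest topology making all the maps \<open>\<mu> \<mapsto> \<integral>h d\<mu>\<close> with continuous \<open>h\<close> continuous.
  It is meant for compact spaces, where continuous functions are bounded.\<close>

definition weak_star :: "'a::topological_space measure topology" where
  "weak_star = topology_generated_by
     {{\<mu> \<in> borel_probabilities. (\<integral>x. h x \<partial>\<mu>) \<in> V} | (h :: 'a \<Rightarrow> real) V.
        continuous_on UNIV h \<and> open V}"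

lemma topspace_weak_star: "topspace weak_star = borel_probabilities"
proof -
  have "borel_probabilities \<in> {{\<mu> \<in> borel_probabilities. (\<integral>x. h x \<partial>\<mu>) \<in> V} |
          (h :: 'a \<Rightarrow> real) V. continuous_on UNIV h \<and> open V}"
    by (auto intro!: exI[of _ "\<lambda>_. 0"] exI[of _ UNIV])
  then show ?thesis
    unfolding weak_star_def topology_generated_by_topspace by blast
qed

section \<open>Observable measures\<close>

definition empirical_measure :: "('a::topological_space \<Rightarrow> 'a) \<Rightarrow> nat \<Rightarrow> 'a \<Rightarrow> 'a measure" where
  "empirical_measure f n x =
     measure_of UNIV (sets borel)
       (\<lambda>A. (\<Sum>j<n. emeasure (return borel ((f ^^ j) x)) A) / ennreal (real n))"

lemma emeasure_empirical_measure:
  assumes "A \<in> sets borel"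
  shows "emeasure (empirical_measure f n x) A =
    (\<Sum>j<n. emeasure (return borel ((f ^^ j) x)) A) / ennreal (real n)"
proof -
  let ?\<mu> = "\<lambda>A. (\<Sum>j<n. emeasure (return borel ((f ^^ j) x)) A) / ennreal (real n)"
  have "countably_additive (sets borel) ?\<mu>"
    unfolding countably_additive_def
  proof (intro allI impI)
    fix B :: "nat \<Rightarrow> 'a set"
    assume B: "range B \<subseteq> sets borel" "disjoint_family B"
    have "(\<Sum>i. emeasure (return borel ((f ^^ j) x)) (B i)) =
        emeasure (return borel ((f ^^ j) x)) (\<Union>i. B i)" for j
      using B by (intro suminf_emeasure) auto
    then show "(\<Sum>i. ?\<mu> (B i)) = ?\<mu> (\<Union>i. B i)"
      by (simp add: divide_ennreal_def suminf_sum)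
  qed
  then show ?thesis
    using assms sets.sigma_algebra_axioms[of "borel :: 'a measure"]
    by (subst empirical_measure_def, subst emeasure_measure_of_sigma)
       (auto simp: positive_def)
qed

definition p_omega :: "('a::topological_space \<Rightarrow> 'a) \<Rightarrow> 'a \<Rightarrow> 'a measure set" where
  "p_omega f x = {\<mu>. \<exists>r :: nat \<Rightarrow> nat. strict_mono r \<and> (\<forall>k. r k \<ge> 1) \<and>
      limitin weak_star (\<lambda>k. empirical_measure f (r k) x) \<mu> sequentially}"

text \<open>The distance of \<open>\<mu>\<close> to a nonempty set \<open>S\<close> of measures, which is the minimum of the
  distances if \<open>S\<close> is compact.\<close>

definition dist_to ::
    "('a measure \<Rightarrow> 'a measure \<Rightarrow> real) \<Rightarrow> 'a measure set \<Rightarrow> 'a measure \<Rightarrow> real" where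
  "dist_to d S \<mu> = (INF \<nu>\<in>S. d \<nu> \<mu>)"

text \<open>On a compact manifold the sets below are Borel when \<open>f\<close> is continuous, \<open>d\<close> is a metric for
  the weak* topology and \<open>K\<close> is compact, so \<open>m\<close> need not be completed.\<close>

definition observable ::
    "'a::topological_space measure \<Rightarrow> ('a measure \<Rightarrow> 'a measure \<Rightarrow> real) \<Rightarrow> ('a \<Rightarrow> 'a) \<Rightarrow>
      'a measure \<Rightarrow> bool" where
  "observable m d f \<mu> \<longleftrightarrow> \<mu> \<in> borel_probabilities \<and>
     (\<forall>\<epsilon>>0. emeasure m {x. dist_to d (p_omega f x) \<mu> < \<epsilon>} > 0)"

definition observable_measures ::
    "'a::topological_space measure \<Rightarrow> ('a measure \<Rightarrow> 'a measure \<Rightarrow> real) \<Rightarrow> ('a \<Rightarrow> 'a) \<Rightarrow>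
      'a measure set" where
  "observable_measures m d f = {\<mu>. observable m d f \<mu>}"

definition basin :: "('a::topological_space \<Rightarrow> 'a) \<Rightarrow> 'a measure set \<Rightarrow> 'a set" where
  "basin f K = {x. p_omega f x \<subseteq> K}"

end

theory Submission
  imports Defs
begin

text \<open>The observable measures form a kind of support. Say that a ball in the space of Borel
  probabilities is negligible if \<open>p\<omega>(x)\<close> meets it only for a null set of points \<open>x\<close>. Then \<open>\<mu>\<close> is
  observable iff no ball centred at \<open>\<mu>\<close> is negligible, and three properties follow as they do for
  the support of a measure. Any measure inside a negligible ball has a smaller negligible ball of
  its own, so the complement of \<open>\<O>\<close> is open; as the space of probabilities is compact, so is \<open>\<O>\<close>
  (\<open>compactin_observable\<close>). By total boundedness countably many negligible balls cover the
  complement of \<open>\<O>\<close>, so the points \<open>x\<close> whose \<open>p\<omega>(x)\<close> leaves \<open>\<O>\<close> form a null set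
  (\<open>basin_observable\<close>). Finally, a measure outside a compact \<open>K\<close> has a ball disjoint from \<open>K\<close>, which
  \<open>p\<omega>(x)\<close> can meet only for \<open>x\<close> outside the basin of \<open>K\<close>; if that basin has full measure, the
  ball is negligible and its centre is not observable (\<open>observable_subset\<close>).

  The argument needs every set \<open>{x. p\<omega>(x) meets a given ball}\<close> to be Borel (\<open>near_borel\<close>). Compactness
  of the space of probabilities turns it into the condition that the empirical measures visit a
  slightly smaller ball infinitely often, and the empirical measures depend continuously on \<open>x\<close>.

  Weak* compactness (\<open>weak_star_convergent_subsequence\<close>) is reduced to Helly's selection theorem on
  the real line. A compact space with a countable base has a Borel injection into \<open>\<real>\<close>, by ternary
  expansions with digits 0 and 2, whose inverse extends to a continuous map \<open>\<phi>\<close> on a compact set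
  of reals. A sequence of probabilities is transported to \<open>\<real>\<close>, Helly's theorem gives a weak limit
  there, and the image of this limit under \<open>\<phi>\<close> is a limit of the original subsequence.\<close>

section \<open>Cantor coding of a compact space\<close>

definition cantor_code :: "(nat \<Rightarrow> bool) \<Rightarrow> real" where
  "cantor_code b = (\<Sum>n. 2 * of_bool (b n) / 3 ^ Suc n)"

lemma sums_ternary_twos: "(\<lambda>n. 2 / 3 ^ Suc n :: real) sums 1"
  using sums_mult[OF geometric_sums[of "1/3 :: real"], of "2/3"]
  by (simp add: power_divide)

lemma summable_cantor_code: "summable (\<lambda>n. 2 * of_bool (b n) / 3 ^ Suc n :: real)"
  by (rule summable_comparison_test'[OF sums_summable[OF sums_ternary_twos], of 0]) auto

lemma cantor_code_bounds: "0 \<le> cantor_code b" "cantor_code b \<le> 1"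
proof -
  show "0 \<le> cantor_code b"
    unfolding cantor_code_def by (intro suminf_nonneg summable_cantor_code) auto
  have "cantor_code b \<le> (\<Sum>n. 2 / 3 ^ Suc n)"
    unfolding cantor_code_def
    by (intro suminf_le summable_cantor_code sums_summable[OF sums_ternary_twos]) auto
  then show "cantor_code b \<le> 1"
    using sums_unique[OF sums_ternary_twos] by simp
qed

lemma cantor_code_shift:
  "cantor_code b = 2 * of_bool (b 0) / 3 + cantor_code (\<lambda>n. b (Suc n)) / 3"
proof -
  have "cantor_code (\<lambda>n. b (Suc n)) / 3 = (\<Sum>n. 2 * of_bool (b (Suc n)) / 3 ^ Suc (Suc n))"
    unfolding cantor_code_def
    using suminf_divide[OF summable_cantor_code[of "\<lambda>n. b (Suc n)"], of 3]
    by (simp add: ac_simps)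
  then show ?thesis
    using suminf_split_head[OF summable_cantor_code[of b]]
    by (simp add: cantor_code_def diff_divide_distrib del: power_Suc)
qed

text \<open>Induction works because shifting both sequences by one place multiplies the difference of the
  codes by 3 when the first digits agree; if they differ, the codes lie in different outer thirds
  of the unit interval.\<close>

lemma cantor_code_separates:
  assumes "b n \<noteq> c n"
  shows "1 / 3 ^ Suc n \<le> \<bar>cantor_code b - cantor_code c\<bar>"
  using assms
proof (induction n arbitrary: b c)
  case 0
  then show ?case
    using cantor_code_bounds[of "\<lambda>n. b (Suc n)"] cantor_code_bounds[of "\<lambda>n. c (Suc n)"]
    by (auto simp: cantor_code_shift[of b] cantor_code_shift[of c] abs_if)
next
  case (Suc n)
  show ?case
  proof (cases "b 0 = c 0")
    case True
    have "cantor_code b - cantor_code c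
        = (cantor_code (\<lambda>n. b (Suc n)) - cantor_code (\<lambda>n. c (Suc n))) / 3"
      using True by (simp add: cantor_code_shift[of b] cantor_code_shift[of c] field_simps)
    then have "\<bar>cantor_code b - cantor_code c\<bar>
        = \<bar>cantor_code (\<lambda>n. b (Suc n)) - cantor_code (\<lambda>n. c (Suc n))\<bar> / 3"
      by (simp only: abs_divide abs_numeral)
    with Suc.IH[of "\<lambda>n. b (Suc n)" "\<lambda>n. c (Suc n)"] Suc.prems show ?thesis
      by simp
  next
    case False
    have "1 / 3 ^ Suc (Suc n) \<le> (1 / 3 :: real)"
      using power_increasing[of 1 "Suc (Suc n)" "3 :: real"] by (simp add: frac_le)
    also have "\<dots> \<le> \<bar>cantor_code b - cantor_code c\<bar>"
      using False cantor_code_bounds[of "\<lambda>n. b (Suc n)"]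
        cantor_code_bounds[of "\<lambda>n. c (Suc n)"]
      by (auto simp: cantor_code_shift[of b] cantor_code_shift[of c] abs_if)
    finally show ?thesis .
  qed
qed

lemma continuous_on_if_compact_graph:
  fixes \<phi> :: "'b::t2_space \<Rightarrow> 'c::topological_space"
  assumes "compact (Sigma C (\<lambda>t. {\<phi> t}))"
  shows "continuous_on C \<phi>"
proof -
  let ?G = "Sigma C (\<lambda>t. {\<phi> t})"
  have image: "closed (fst ` (?G \<inter> UNIV \<times> D))" if "closed D" for D
    using assms that
    by (intro compact_imp_closed compact_continuous_image compact_Int_closed closed_Times
        continuous_intros) auto
  have "closed C"
    using image[of UNIV] by (simp add: image_def)
  moreover have "\<phi> -` D \<inter> C = fst ` (?G \<inter> UNIV \<times> D)" for D
    by force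
  ultimately show ?thesis
    using image by (simp add: continuous_on_closed_vimage)
qed

text \<open>The \<open>n\<close>-th digit of \<open>s x\<close> records whether \<open>x\<close> lies in the \<open>n\<close>-th set of a countable base.
  In general \<open>s\<close> is not continuous and its range is not closed; what makes the decoding map \<open>\<phi>\<close>
  continuous is that the closure of the graph of \<open>s\<close> is compact and still the graph of a function
  of the code.\<close>

lemma compact_space_real_coding:
  assumes "compact (UNIV :: 'a::{second_countable_topology, t2_space} set)"
  obtains s :: "'a::{second_countable_topology, t2_space} \<Rightarrow> real" and C \<phi> where
    "s \<in> borel_measurable borel" "compact C" "range s \<subseteq> C" "continuous_on C \<phi>"
    "\<And>x. \<phi> (s x) = x"
proof -
  obtain B :: "'a set set" where B: "countable B" "topological_basis B"
    using ex_countable_basis by blast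
  have "B \<noteq> {}"
    using B(2) by (force simp: topological_basis_def dest: spec[of _ UNIV])
  define U where "U = from_nat_into B"
  have range_U: "range U = B"
    using B(1) \<open>B \<noteq> {}\<close> by (simp add: U_def range_from_nat_into)
  have open_U: "open (U n)" for n
    using range_U B(2) topological_basis_open by blast
  define s where "s = (\<lambda>x. cantor_code (\<lambda>n. x \<in> U n))"
  define K where "K = closure (range (\<lambda>x. (s x, x)))"
  have s_eq: "s = (\<lambda>x. \<Sum>n. 2 * indicator (U n) x / 3 ^ Suc n)"
    by (simp add: s_def cantor_code_def indicator_def of_bool_def)
  have meas: "s \<in> borel_measurable borel"
    unfolding s_eq using open_U by (intro borel_measurable_suminf) auto
  have "K \<subseteq> {0..1} \<times> UNIV"
    unfolding K_def
    by (intro closure_minimal closed_Times) (auto simp: s_def cantor_code_bounds)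
  then have comp: "compact K"
    using compact_Int_closed[OF compact_Times[OF compact_Icc assms], of K 0 1]
    by (simp add: K_def Int_absorb1)
  \<comment> \<open>If two points shared the code \<open>t\<close>, some \<open>U n\<close> would separate them, hence also nearby points
    of the graph of \<open>s\<close>; these have codes arbitrarily close to \<open>t\<close> that differ in digit \<open>n\<close>.\<close>
  have unique: "x = y" if xy: "(t, x) \<in> K" "(t, y) \<in> K" for t x y
  proof (rule ccontr)
    assume "x \<noteq> y"
    then obtain V W where VW: "open V" "open W" "x \<in> V" "y \<in> W" "V \<inter> W = {}"
      using separation_t2[of x y] by blast
    obtain n where n: "x \<in> U n" "U n \<subseteq> V"
      using topological_basisE[OF B(2) VW(1) VW(3)] range_U by (metis rangeE)
    let ?I = "ball t (1 / 2 / 3 ^ Suc n)"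
    have approx: "\<exists>z\<in>D. s z \<in> ?I" if "(t, w) \<in> K" "open D" "w \<in> D" for w D
    proof -
      have "(t, w) \<in> ?I \<times> D"
        using that by simp
      moreover have "open (?I \<times> D)"
        using that by (intro open_Times) auto
      ultimately have "(?I \<times> D) \<inter> range (\<lambda>x. (s x, x)) \<noteq> {}"
        using that(1) open_Int_closure_eq_empty unfolding K_def by blast
      then show ?thesis by blast
    qed
    obtain x' where x': "x' \<in> U n" "s x' \<in> ?I"
      using approx[OF xy(1) open_U n(1)] by blast
    obtain y' where y': "y' \<in> W" "s y' \<in> ?I"
      using approx[OF xy(2) VW(2,4)] by blast
    have "y' \<notin> U n"
      using y' n VW by blast
    then have "1 / 3 ^ Suc n \<le> \<bar>s x' - s y'\<bar>"
      unfolding s_def using x' by (intro cantor_code_separates) auto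
    moreover have "\<bar>s x' - s y'\<bar> < 1 / 2 / 3 ^ Suc n + 1 / 2 / 3 ^ Suc n"
      using x'(2) y'(2) unfolding mem_ball dist_real_def by linarith
    ultimately show False by (simp add: field_simps)
  qed
  define C where "C = fst ` K"
  define \<phi> where "\<phi> = (\<lambda>t. SOME x. (t, x) \<in> K)"
  have graph: "(t, \<phi> t) \<in> K" if "t \<in> C" for t
    using that unfolding C_def \<phi>_def by (auto intro: someI)
  have sK: "(s x, x) \<in> K" for x
    unfolding K_def using closure_subset[of "range (\<lambda>x. (s x, x))"] by blast
  have sC: "s x \<in> C" for x
    unfolding C_def using sK by force
  have "(t, x) \<in> K \<longleftrightarrow> t \<in> C \<and> x = \<phi> t" for t x
  proof
    assume tx: "(t, x) \<in> K"
    then have "t \<in> C"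
      unfolding C_def by (metis fst_conv imageI)
    with tx show "t \<in> C \<and> x = \<phi> t"
      using unique graph by blast
  qed (use graph in blast)
  then have "K = Sigma C (\<lambda>t. {\<phi> t})"
    by auto
  then have "continuous_on C \<phi>"
    using comp by (intro continuous_on_if_compact_graph) simp
  moreover have "compact C"
    unfolding C_def using comp by (intro compact_continuous_image continuous_intros)
  moreover have "\<phi> (s x) = x" for x
    using unique[OF graph[OF sC] sK] .
  ultimately show thesis
    using that[OF meas] sC by blast
qed

section \<open>Sequential compactness of the weak* topology\<close>

lemma borel_probabilities_D:
  assumes "\<mu> \<in> borel_probabilities"
  shows "prob_space \<mu>" "sets \<mu> = sets borel"
  using assms by (auto simp: borel_probabilities_def)

lemma limitin_weak_star_iff:
  "limitin weak_star (\<mu> :: nat \<Rightarrow> 'a::topological_space measure) \<nu> sequentially \<longleftrightarrow>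
     \<nu> \<in> borel_probabilities \<and>
     (\<forall>\<^sub>F n in sequentially. \<mu> n \<in> borel_probabilities) \<and>
     (\<forall>h :: 'a \<Rightarrow> real. continuous_on UNIV h \<longrightarrow>
        (\<lambda>n. \<integral>x. h x \<partial>\<mu> n) \<longlonglongrightarrow> (\<integral>x. h x \<partial>\<nu>))"
    (is "?L \<longleftrightarrow> ?R")
proof
  assume L: ?L
  have "openin weak_star {\<mu> \<in> borel_probabilities. (\<integral>x. h x \<partial>\<mu>) \<in> V}"
    if "continuous_on UNIV h" "open V" for h :: "'a \<Rightarrow> real" and V
    unfolding weak_star_def using that by (intro topology_generated_by_Basis) blast
  then have *: "\<forall>\<^sub>F n in sequentially. \<mu> n \<in> {\<mu> \<in> borel_probabilities. (\<integral>x. h x \<partial>\<mu>) \<in> V}"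
    if "continuous_on UNIV h" "open V" "(\<integral>x. h x \<partial>\<nu>) \<in> V" for h :: "'a \<Rightarrow> real" and V
    using L that unfolding limitin_def topspace_weak_star by blast
  have "\<forall>\<^sub>F n in sequentially. \<mu> n \<in> borel_probabilities"
    using *[of "\<lambda>_. 0" UNIV] by simp
  moreover have "(\<lambda>n. \<integral>x. h x \<partial>\<mu> n) \<longlonglongrightarrow> (\<integral>x. h x \<partial>\<nu>)" if "continuous_on UNIV h"
    for h :: "'a \<Rightarrow> real"
    unfolding tendsto_def using *[OF that] by (simp add: eventually_conj_iff)
  ultimately show ?R
    using L by (simp add: limitin_def topspace_weak_star)
next
  assume R: ?R
  have "\<forall>\<^sub>F n in sequentially. \<mu> n \<in> S" if "openin weak_star S" "\<nu> \<in> S" for S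
    using openin_topology_generated_by[OF that(1)[unfolded weak_star_def]] that(2)
  proof (induction rule: generate_topology_on.induct)
    case (UN \<K>)
    then obtain S where "S \<in> \<K>" "\<forall>\<^sub>F n in sequentially. \<mu> n \<in> S"
      by blast
    then show ?case
      by (auto elim: eventually_mono)
  next
    case (Basis S)
    then obtain h :: "'a \<Rightarrow> real" and V where
      "S = {\<mu> \<in> borel_probabilities. (\<integral>x. h x \<partial>\<mu>) \<in> V}" "continuous_on UNIV h" "open V"
      by blast
    with R Basis show ?case
      by (auto simp: eventually_conj_iff tendsto_def)
  qed (auto simp: eventually_conj_iff)
  then show ?L
    using R by (auto simp: limitin_def topspace_weak_star)
qed

text \<open>Transport to \<open>\<real>\<close> by the coding \<open>s\<close>, apply Helly's selection theorem, return by the decoding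
  map. A continuous \<open>h\<close> is tested on the real line through a Tietze extension \<open>H\<close> of \<open>h \<circ> \<phi>\<close>: then
  \<open>H (s x) = h x\<close>, although \<open>s\<close> itself need not be continuous.\<close>

lemma weak_star_convergent_subsequence:
  fixes \<mu> :: "nat \<Rightarrow> 'a::{second_countable_topology, t2_space} measure"
  assumes compact: "compact (UNIV :: 'a set)"
    and \<mu>: "\<And>n. \<mu> n \<in> borel_probabilities"
  obtains r \<nu> where "strict_mono (r :: nat \<Rightarrow> nat)" "limitin weak_star (\<mu> \<circ> r) \<nu> sequentially"
proof -
  obtain s :: "'a \<Rightarrow> real" and C \<phi> where s: "s \<in> borel_measurable borel"
    and C: "compact C" "range s \<subseteq> C" and \<phi>: "continuous_on C \<phi>" "\<And>x. \<phi> (s x) = x"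
    using compact_space_real_coding[OF compact] by blast
  have s_C: "s x \<in> C" for x
    using C(2) by blast
  have closed_C: "closed C"
    using C(1) by (rule compact_imp_closed)
  interpret \<mu>: prob_space "\<mu> n" for n
    using \<mu> by (simp add: borel_probabilities_D)
  have sets_\<mu> [measurable_cong]: "sets (\<mu> n) = sets borel" for n
    using \<mu> by (simp add: borel_probabilities_D)
  have s_\<mu> [measurable]: "s \<in> borel_measurable (\<mu> n)" for n
    using s by (simp add: measurable_cong_sets[OF sets_\<mu> refl])
  define law where "law n = distr (\<mu> n) borel s" for n
  have real: "real_distribution (law n)" for n
    unfolding law_def by simp
  have "tight law"
  proof -
    obtain a where a: "0 < a" "\<And>t. t \<in> C \<Longrightarrow> \<bar>t\<bar> \<le> a"
      using compact_imp_bounded[OF C(1)] by (auto simp: bounded_pos)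
    have "measure (law n) {-a - 1<..a} = 1" for n
    proof -
      have "s x \<in> {-a - 1<..a}" for x
        using a(2)[OF s_C, of x] by auto
      then have "s -` {-a - 1<..a} \<inter> space (\<mu> n) = space (\<mu> n)"
        by blast
      then show ?thesis
        unfolding law_def by (simp add: measure_distr \<mu>.prob_space)
    qed
    then have "\<exists>a b. a < b \<and> (\<forall>n. 1 - \<epsilon> < measure (law n) {a<..b})" if "\<epsilon> > 0" for \<epsilon>
      using a(1) that by (intro exI[of _ "-a - 1"] exI[of _ a]) simp
    then show ?thesis
      unfolding tight_def using real by simp
  qed
  then obtain r M where r: "strict_mono (r :: nat \<Rightarrow> nat)" and M: "real_distribution M"
    and "weak_conv_m (law \<circ> id \<circ> r) M"
    using tight_imp_convergent_subsubsequence[of law id] by (auto simp: strict_mono_def)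
  then have conv: "weak_conv_m (\<lambda>n. law (r n)) M"
    by (simp add: comp_def)
  interpret M: real_distribution M by fact
  have integral_conv: "(\<lambda>n. \<integral>x. H (s x) \<partial>\<mu> (r n)) \<longlonglongrightarrow> (\<integral>t. H t \<partial>M)"
    if "continuous_on UNIV H" "\<And>t. norm (H t) \<le> b" for H :: "real \<Rightarrow> real" and b
  proof -
    have [measurable]: "H \<in> borel_measurable borel"
      using that(1) by (rule borel_measurable_continuous_onI)
    have "(\<lambda>n. integral\<^sup>L (law (r n)) H) \<longlonglongrightarrow> integral\<^sup>L M H"
      using weak_conv_imp_integral_bdd_continuous_conv[OF real M conv, of H b] that
      by (auto simp: continuous_on_eq_continuous_at)
    then show ?thesis
      unfolding law_def by (simp add: integral_distr)
  qed
  \<comment> \<open>The codes lie in the closed set \<open>C\<close>, so the limit law cannot charge its complement: the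
    truncated distance to \<open>C\<close> has integral 0 along the sequence, hence in the limit.\<close>
  have M_C: "AE t in M. t \<in> C"
  proof -
    let ?H = "\<lambda>t. min 1 (infdist t C)"
    have "C \<noteq> {}"
      using C(2) by blast
    have H: "continuous_on UNIV ?H"
      by (intro continuous_intros)
    have "(\<lambda>n. \<integral>x. ?H (s x) \<partial>\<mu> (r n)) \<longlonglongrightarrow> (\<integral>t. ?H t \<partial>M)"
      by (rule integral_conv[OF H, of 1]) (auto simp: infdist_nonneg)
    moreover have "?H (s x) = 0" for x
      using s_C by simp
    ultimately have "(\<integral>t. ?H t \<partial>M) = 0"
      by (simp add: LIMSEQ_const_iff)
    moreover have "integrable M ?H"
      using borel_measurable_continuous_onI[OF H]
      by (intro M.integrable_const_bound[of _ 1])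
        (simp_all add: infdist_nonneg measurable_cong_sets[OF M.events_eq_borel refl])
    ultimately have "AE t in M. ?H t = 0"
      by (subst (asm) integral_nonneg_eq_0_iff_AE) (auto simp: infdist_nonneg)
    then show ?thesis
      using in_closed_iff_infdist_zero[OF closed_C \<open>C \<noteq> {}\<close>]
      by (auto simp: min_def split: if_splits)
  qed
  \<comment> \<open>\<open>M\<close> gives measure 0 to \<open>- C\<close>, so the constant value there only serves measurability.\<close>
  define \<psi> where "\<psi> t = (if t \<in> C then \<phi> t else undefined)" for t
  have \<psi> [measurable]: "\<psi> \<in> borel_measurable M"
    unfolding \<psi>_def measurable_cong_sets[OF M.events_eq_borel refl]
    using closed_C by (intro borel_measurable_continuous_on_if \<phi>(1)) (auto intro: continuous_intros)
  define \<nu> where "\<nu> = distr M borel \<psi>"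
  have "\<nu> \<in> borel_probabilities"
    unfolding borel_probabilities_def \<nu>_def by (auto intro: M.prob_space_distr)
  moreover have "(\<lambda>n. \<integral>x. h x \<partial>\<mu> (r n)) \<longlonglongrightarrow> (\<integral>x. h x \<partial>\<nu>)"
    if h: "continuous_on UNIV h" for h :: "'a \<Rightarrow> real"
  proof -
    have "continuous_on C (\<lambda>t. h (\<phi> t))"
      using continuous_on_compose2[OF h \<phi>(1)] by simp
    moreover obtain b where "0 < b" "\<And>x. norm (h x) \<le> b"
      using compact_imp_bounded[OF compact_continuous_image[OF h compact]]
      by (auto simp: bounded_pos)
    ultimately obtain H where H: "continuous_on UNIV H" "\<And>t. t \<in> C \<Longrightarrow> H t = h (\<phi> t)"
      "\<And>t. norm (H t) \<le> b"
      using Tietze[of C "\<lambda>t. h (\<phi> t)" UNIV b] closed_C by auto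
    have [measurable]: "h \<in> borel_measurable borel" "H \<in> borel_measurable borel"
      using h H(1) by (auto intro: borel_measurable_continuous_onI)
    have "H (s x) = h x" for x
      using H(2)[OF s_C] \<phi>(2) by simp
    moreover have "(\<integral>x. h x \<partial>\<nu>) = (\<integral>t. h (\<psi> t) \<partial>M)"
      unfolding \<nu>_def by (simp add: integral_distr)
    moreover have "\<dots> = (\<integral>t. H t \<partial>M)"
    proof (rule integral_cong_AE)
      show "AE t in M. h (\<psi> t) = H t"
        using M_C by eventually_elim (simp add: \<psi>_def H(2))
    qed measurable
    ultimately show ?thesis
      using integral_conv[OF H(1,3)] by simp
  qed
  ultimately have "limitin weak_star (\<mu> \<circ> r) \<nu> sequentially"
    using \<mu> by (simp add: limitin_weak_star_iff)
  with r show thesis by (rule that)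
qed

section \<open>Empirical measures\<close>

text \<open>As the law of a point chosen uniformly from the orbit segment, the empirical measure inherits
  its integrals and its total mass from the uniform distribution on \<open>{..<n}\<close>.\<close>

lemma empirical_measure_eq_distr:
  assumes "n \<ge> 1"
  shows "empirical_measure f n x =
    distr (measure_pmf (pmf_of_set {..<n})) borel (\<lambda>j. (f ^^ j) x)" (is "_ = ?D")
proof (rule measure_eqI)
  show "sets (empirical_measure f n x) = sets ?D"
    using sets.sigma_sets_eq[of "borel :: 'a measure"]
    by (simp add: empirical_measure_def sets_measure_of_conv)
  fix A assume "A \<in> sets (empirical_measure f n x)"
  then have A: "A \<in> sets borel"
    using sets.sigma_sets_eq[of "borel :: 'a measure"]
    by (simp add: empirical_measure_def sets_measure_of_conv)
  have "emeasure ?D A = card ({..<n} \<inter> (\<lambda>j. (f ^^ j) x) -` A) / real n"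
    using assms A by (simp add: emeasure_distr emeasure_pmf_of_set lessThan_empty_iff)
  also have "real (card ({..<n} \<inter> (\<lambda>j. (f ^^ j) x) -` A)) = (\<Sum>j<n. indicator A ((f ^^ j) x))"
    by (simp add: indicator_def sum.If_cases Int_def)
  finally show "emeasure (empirical_measure f n x) A = emeasure ?D A"
    using assms A
    by (simp add: emeasure_empirical_measure divide_ennreal[symmetric] sum_nonneg
        ennreal_indicator flip: sum_ennreal)
qed

lemma empirical_measure_in_borel_probabilities:
  assumes "n \<ge> 1"
  shows "empirical_measure f n x \<in> borel_probabilities"
  using assms unfolding borel_probabilities_def
  by (auto simp: empirical_measure_eq_distr intro!: measure_pmf.prob_space_distr)

lemma integral_empirical_measure:
  fixes h :: "'a::topological_space \<Rightarrow> real"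
  assumes "n \<ge> 1" "h \<in> borel_measurable borel"
  shows "(\<integral>y. h y \<partial>empirical_measure f n x) = (\<Sum>j<n. h ((f ^^ j) x)) / real n"
  using assms
  by (simp add: empirical_measure_eq_distr integral_distr integral_pmf_of_set lessThan_empty_iff)

lemma continuous_map_empirical_measure:
  fixes f :: "'a::topological_space \<Rightarrow> 'a"
  assumes "n \<ge> 1" "continuous_on UNIV f"
  shows "continuous_map euclidean weak_star (empirical_measure f n)"
  unfolding weak_star_def
proof (rule continuous_on_generated_topo)
  have iterate: "continuous_on UNIV (f ^^ j)" for j
    by (induction j) (auto intro: continuous_on_compose2[OF assms(2)] continuous_on_id)
  show "openin euclidean (empirical_measure f n -` U \<inter> topspace euclidean)"
    if "U \<in> {{\<mu> \<in> borel_probabilities. (\<integral>x. h x \<partial>\<mu>) \<in> V} |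
         (h :: 'a \<Rightarrow> real) V. continuous_on UNIV h \<and> open V}" for U
  proof -
    from that obtain h :: "'a \<Rightarrow> real" and V where
      U: "U = {\<mu> \<in> borel_probabilities. (\<integral>x. h x \<partial>\<mu>) \<in> V}"
      and h: "continuous_on UNIV h" and V: "open V"
      by blast
    have "empirical_measure f n -` U = (\<lambda>x. (\<Sum>j<n. h ((f ^^ j) x)) / real n) -` V"
      using assms(1) h
      by (auto simp: U empirical_measure_in_borel_probabilities integral_empirical_measure
          borel_measurable_continuous_onI)
    moreover have "continuous_on UNIV (\<lambda>x. (\<Sum>j<n. h ((f ^^ j) x)) / real n)"
      using assms(1) by (intro continuous_intros continuous_on_compose2[OF h iterate]) auto
    ultimately show ?thesis
      using V by (simp add: open_vimage)
  qed
  show "empirical_measure f n ` topspace euclidean \<subseteq>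
      \<Union> {{\<mu> \<in> borel_probabilities. (\<integral>x. h x \<partial>\<mu>) \<in> V} |
         (h :: 'a \<Rightarrow> real) V. continuous_on UNIV h \<and> open V}"
    using topspace_weak_star empirical_measure_in_borel_probabilities[OF assms(1)]
    unfolding weak_star_def topology_generated_by_topspace by blast
qed

section \<open>Limit measures and observable measures\<close>

locale empirical_dynamics = Metric_space "borel_probabilities :: 'a measure set" d
  for d :: "'a::{second_countable_topology, t2_space} measure \<Rightarrow> 'a measure \<Rightarrow> real" +
  fixes f :: "'a \<Rightarrow> 'a" and m :: "'a measure"
  assumes compact: "compact (UNIV :: 'a set)"
    and mtopology: "mtopology = weak_star"
    and continuous_f: "continuous_on UNIV f"
    and sets_m: "sets m = sets borel"
    and prob_m: "prob_space m"
begin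

abbreviation P :: "'a measure set" where "P \<equiv> borel_probabilities"

lemma compactin_P: "compactin weak_star P"
proof -
  have "\<exists>l r. l \<in> P \<and> strict_mono r \<and> limitin weak_star (\<sigma> \<circ> r) l sequentially"
    if "range \<sigma> \<subseteq> P" for \<sigma> :: "nat \<Rightarrow> 'a measure"
    using weak_star_convergent_subsequence[OF compact, of \<sigma>] that
    by (metis limitin_weak_star_iff rangeI subsetD)
  then show ?thesis
    using compactin_sequentially[of P] by (simp add: mtopology)
qed

lemma p_omega_subset: "p_omega f x \<subseteq> P"
  unfolding p_omega_def by (auto simp: limitin_weak_star_iff)
text \<open>This converse to the definition of \<open>p\<omega>(x)\<close> is where compactness of the space of probabilities
  enters the dynamics: infinitely many visits to a closed set leave a limit in it.\<close>

lemma p_omega_meets_if_frequently: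
  assumes "\<exists>\<^sub>F n in sequentially. empirical_measure f n x \<in> S" "closedin weak_star S"
  obtains \<nu> where "\<nu> \<in> p_omega f x" "\<nu> \<in> S"
proof -
  have "infinite {n. n \<ge> 1 \<and> empirical_measure f n x \<in> S}"
  proof -
    have "\<exists>\<^sub>F n in sequentially. n \<ge> 1 \<and> empirical_measure f n x \<in> S"
      using frequently_eventually_conj[OF assms(1) eventually_ge_at_top[of 1]] by simp
    then show ?thesis
      by (simp add: frequently_cofinite flip: cofinite_eq_sequentially)
  qed
  then obtain r :: "nat \<Rightarrow> nat" where r: "strict_mono r"
    "\<And>k. r k \<ge> 1" "\<And>k. empirical_measure f (r k) x \<in> S"
    using infinite_enumerate[of "{n. n \<ge> 1 \<and> empirical_measure f n x \<in> S}"] by auto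
  obtain r' \<nu> where r': "strict_mono r'"
    "limitin weak_star ((\<lambda>k. empirical_measure f (r k) x) \<circ> r') \<nu> sequentially"
    using weak_star_convergent_subsequence[OF compact,
        of "\<lambda>k. empirical_measure f (r k) x"] r(2)
    by (metis empirical_measure_in_borel_probabilities)
  have "\<nu> \<in> p_omega f x"
    unfolding p_omega_def using r r' strict_mono_o[OF r(1) r'(1)]
    by (auto intro!: exI[of _ "r \<circ> r'"] simp: comp_def)
  moreover have "\<nu> \<in> S"
    using limitin_closedin[OF r'(2) assms(2)] r(3) by simp
  ultimately show thesis by (rule that)
qed

lemma p_omega_nonempty: "p_omega f x \<noteq> {}"
proof -
  have "\<forall>\<^sub>F n in sequentially. empirical_measure f n x \<in> P"
    using eventually_ge_at_top[of "1::nat"]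
    by eventually_elim (rule empirical_measure_in_borel_probabilities)
  moreover have "closedin weak_star P"
    using closedin_topspace[of weak_star] by (simp add: topspace_weak_star)
  ultimately show ?thesis
    using p_omega_meets_if_frequently eventually_frequently[OF sequentially_bot] by blast
qed

text \<open>\<open>near \<mu> \<epsilon>\<close> is the set in the definition of observability. Saying that \<open>p\<omega>(x)\<close> meets the open
  ball avoids the infimum in \<open>dist_to\<close>; the two agree because \<open>p\<omega>(x)\<close> is nonempty.\<close>

definition near :: "'a measure \<Rightarrow> real \<Rightarrow> 'a set" where
  "near \<mu> \<epsilon> = {x. \<exists>\<nu>\<in>p_omega f x. d \<nu> \<mu> < \<epsilon>}"

lemma dist_to_less_iff: "dist_to d (p_omega f x) \<mu> < \<epsilon> \<longleftrightarrow> x \<in> near \<mu> \<epsilon>"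
  unfolding dist_to_def near_def
  by (subst cInf_less_iff) (auto intro: bdd_belowI2[of _ 0] simp: p_omega_nonempty)

text \<open>The margin \<open>1 / Suc j\<close> closes the gap between the open ball and its closure: a limit inside the
  ball stays inside a smaller one, and infinitely many visits to the smaller ball only yield a
  limit in the corresponding closed ball, which the original ball contains.\<close>

lemma near_iff_frequently:
  assumes "\<mu> \<in> P"
  shows "x \<in> near \<mu> \<epsilon> \<longleftrightarrow>
    (\<exists>j::nat. \<exists>\<^sub>F n in sequentially. empirical_measure f n x \<in> mball \<mu> (\<epsilon> - 1 / Suc j))"
proof
  assume "x \<in> near \<mu> \<epsilon>"
  then obtain \<nu> where \<nu>: "\<nu> \<in> p_omega f x" "d \<nu> \<mu> < \<epsilon>"
    unfolding near_def by blast
  then obtain j :: nat where "1 / Suc j < \<epsilon> - d \<nu> \<mu>"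
    using nat_approx_posE[of "\<epsilon> - d \<nu> \<mu>"] by auto
  then have in_ball: "\<nu> \<in> mball \<mu> (\<epsilon> - 1 / Suc j)"
    using assms \<nu> p_omega_subset by (auto simp: commute)
  obtain r :: "nat \<Rightarrow> nat" where r: "strict_mono r"
    "limitin weak_star (\<lambda>k. empirical_measure f (r k) x) \<nu> sequentially"
    using \<nu>(1) unfolding p_omega_def by blast
  have "\<forall>\<^sub>F k in sequentially. empirical_measure f (r k) x \<in> mball \<mu> (\<epsilon> - 1 / Suc j)"
    using r(2) in_ball openin_mball unfolding mtopology limitin_def by blast
  then have "\<exists>\<^sub>F n in filtermap r sequentially.
      empirical_measure f n x \<in> mball \<mu> (\<epsilon> - 1 / Suc j)"
    unfolding frequently_filtermap
    by (rule eventually_frequently[OF sequentially_bot])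
  then have "\<exists>\<^sub>F n in sequentially. empirical_measure f n x \<in> mball \<mu> (\<epsilon> - 1 / Suc j)"
    using filterlim_subseq[OF r(1)] by (auto simp: filterlim_def frequently_def le_filter_def)
  then show "\<exists>j::nat. \<exists>\<^sub>F n in sequentially.
      empirical_measure f n x \<in> mball \<mu> (\<epsilon> - 1 / Suc j)" ..
next
  assume "\<exists>j::nat. \<exists>\<^sub>F n in sequentially.
    empirical_measure f n x \<in> mball \<mu> (\<epsilon> - 1 / Suc j)"
  then obtain j :: nat where
    "\<exists>\<^sub>F n in sequentially. empirical_measure f n x \<in> mball \<mu> (\<epsilon> - 1 / Suc j)" ..
  then have "\<exists>\<^sub>F n in sequentially. empirical_measure f n x \<in> mcball \<mu> (\<epsilon> - 1 / Suc j)"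
    by (rule frequently_elim1) (use mball_subset_mcball in blast)
  then obtain \<nu> where \<nu>: "\<nu> \<in> p_omega f x" "\<nu> \<in> mcball \<mu> (\<epsilon> - 1 / Suc j)"
    using p_omega_meets_if_frequently closedin_mcball unfolding mtopology by blast
  then have "d \<mu> \<nu> \<le> \<epsilon> - 1 / Suc j"
    by simp
  moreover have "1 / real (Suc j) > 0"
    by simp
  ultimately have "d \<nu> \<mu> < \<epsilon>"
    using commute[of \<mu> \<nu>] by linarith
  then show "x \<in> near \<mu> \<epsilon>"
    using \<nu>(1) unfolding near_def by blast
qed

lemma near_borel:
  assumes "\<mu> \<in> P"
  shows "near \<mu> \<epsilon> \<in> sets m"
proof -
  have "open {x. empirical_measure f n x \<in> mball \<mu> \<delta>}" if "n \<ge> 1" for n \<delta>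
    using openin_continuous_map_preimage[OF continuous_map_empirical_measure[OF that continuous_f]]
      openin_mball[of \<mu> \<delta>]
    by (simp add: mtopology del: in_mball)
  then have meas: "{x. empirical_measure f n x \<in> mball \<mu> \<delta>} \<in> sets m" if "n \<ge> 1" for n \<delta>
    using that sets_m by simp
  have frequently_ge_Suc: "(\<exists>\<^sub>F n in sequentially. Q n) \<longleftrightarrow> (\<forall>N. \<exists>n\<ge>Suc N. Q n)" for Q
    unfolding frequently_sequentially by (meson Suc_leD)
  have "near \<mu> \<epsilon> = (\<Union>j::nat. \<Inter>N. \<Union>n\<in>{Suc N..}.
      {x. empirical_measure f n x \<in> mball \<mu> (\<epsilon> - 1 / Suc j)})"
    unfolding set_eq_iff near_iff_frequently[OF assms] frequently_ge_Suc
    by (simp add: Bex_def del: in_mball)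
  also have "\<dots> \<in> sets m"
    using sets.top[of m] sets_eq_imp_space_eq[OF sets_m]
    by (intro sets.countable_UN'' sets.countable_INT'' sets.countable_UN')
      (auto intro: meas simp del: in_mball simp: sets_m[symmetric])
  finally show ?thesis .
qed

abbreviation \<O> :: "'a measure set" where "\<O> \<equiv> observable_measures m d f"

text \<open>Since \<open>near \<mu> \<epsilon>\<close> is measurable, positive measure and not being a null set are the same.\<close>

lemma observable_iff:
  "\<mu> \<in> \<O> \<longleftrightarrow> \<mu> \<in> P \<and> (\<forall>\<epsilon>>0. near \<mu> \<epsilon> \<notin> null_sets m)"
  unfolding observable_measures_def observable_def mem_Collect_eq dist_to_less_iff
    Collect_mem_eq
  using near_borel by (auto simp: null_sets_def zero_less_iff_neq_zero)

lemma not_observable_if_near_null: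
  assumes "near \<mu> \<epsilon> \<in> null_sets m" "\<mu> \<in> P" "\<nu> \<in> P" "d \<nu> \<mu> < \<epsilon>"
  shows "\<nu> \<notin> \<O>"
proof -
  have "near \<nu> (\<epsilon> - d \<nu> \<mu>) \<subseteq> near \<mu> \<epsilon>"
    unfolding near_def
  proof safe
    fix x \<kappa> assume "\<kappa> \<in> p_omega f x" "d \<kappa> \<nu> < \<epsilon> - d \<nu> \<mu>"
    moreover from this have "d \<kappa> \<mu> \<le> d \<kappa> \<nu> + d \<nu> \<mu>"
      using assms p_omega_subset by (intro triangle) auto
    ultimately show "\<exists>\<nu>\<in>p_omega f x. d \<nu> \<mu> < \<epsilon>"
      by (intro bexI[of _ \<kappa>]) auto
  qed
  then have "near \<nu> (\<epsilon> - d \<nu> \<mu>) \<in> null_sets m"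
    using assms near_borel null_sets_subset by blast
  then show ?thesis
    using assms(4) observable_iff[of \<nu>] by auto
qed

lemma compactin_observable: "compactin weak_star \<O>"
proof -
  have "openin mtopology (P - \<O>)"
    unfolding openin_mtopology
  proof safe
    fix \<mu> assume "\<mu> \<in> P" "\<mu> \<notin> \<O>"
    then obtain \<epsilon> where \<epsilon>: "\<epsilon> > 0" "near \<mu> \<epsilon> \<in> null_sets m"
      using observable_iff by blast
    have "mball \<mu> \<epsilon> \<subseteq> P - \<O>"
      using not_observable_if_near_null[OF \<epsilon>(2)] by (auto simp: commute)
    then show "\<exists>r>0. mball \<mu> r \<subseteq> P - \<O>"
      using \<epsilon>(1) by blast
  qed
  moreover have "\<O> \<subseteq> P"
    using observable_iff by blast
  ultimately have "closedin weak_star \<O>"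
    by (simp add: closedin_def mtopology topspace_weak_star)
  with \<open>\<O> \<subseteq> P\<close> show ?thesis
    by (intro closed_compactin[OF compactin_P])
qed

text \<open>The complement of the basin is the union of the countably many sets \<open>near p (1 / Suc k)\<close> that
  are null, where \<open>p\<close> runs through a finite \<open>1 / Suc k\<close>-net: every measure outside \<open>\<O>\<close> lies in one
  of these balls once \<open>2 / Suc k\<close> is below the radius of a negligible ball around it.\<close>

lemma basin_observable: "emeasure m (basin f \<O>) = 1"
proof -
  have "\<exists>F. finite F \<and> F \<subseteq> P \<and> P \<subseteq> (\<Union>p\<in>F. mball p (1 / Suc k))" for k :: nat
    using compactin_imp_mtotally_bounded[of P] compactin_P
    unfolding mtotally_bounded_def mtopology by simp
  then obtain F where F: "\<And>k. finite (F k)" "\<And>k. F k \<subseteq> P"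
    "\<And>k::nat. P \<subseteq> (\<Union>p\<in>F k. mball p (1 / Suc k))"
    by metis
  define Z where "Z k = (\<Union>p \<in> {p \<in> F k. near p (1 / Suc k) \<in> null_sets m}. near p (1 / Suc k))"
    for k :: nat
  have "Z k \<in> null_sets m" for k
    unfolding Z_def using F(1) by (intro null_sets_UN' countable_finite) auto
  then have null: "(\<Union>k. Z k) \<in> null_sets m"
    by (rule null_sets_UN)
  have "- basin f \<O> = (\<Union>k. Z k)"
  proof (intro equalityI subsetI)
    fix x assume "x \<in> - basin f \<O>"
    then obtain \<nu> where \<nu>: "\<nu> \<in> p_omega f x" "\<nu> \<notin> \<O>"
      unfolding basin_def by blast
    with p_omega_subset have "\<nu> \<in> P" by blast
    then obtain \<epsilon> where \<epsilon>: "\<epsilon> > 0" "near \<nu> \<epsilon> \<in> null_sets m"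
      using \<nu>(2) observable_iff by blast
    obtain k :: nat where k: "1 / Suc k < \<epsilon> / 2"
      using nat_approx_posE[of "\<epsilon> / 2"] \<epsilon>(1) by auto
    obtain p where p: "p \<in> F k" "p \<in> P" "d \<nu> p < 1 / Suc k"
      using F(2,3)[of k] \<open>\<nu> \<in> P\<close> commute by fastforce
    have "near p (1 / Suc k) \<subseteq> near \<nu> \<epsilon>"
      unfolding near_def
    proof safe
      fix y \<mu> assume \<mu>: "\<mu> \<in> p_omega f y" "d \<mu> p < 1 / Suc k"
      then have "d \<mu> \<nu> \<le> d \<mu> p + d p \<nu>"
        using p \<open>\<nu> \<in> P\<close> p_omega_subset by (intro triangle) auto
      then show "\<exists>\<mu>\<in>p_omega f y. d \<mu> \<nu> < \<epsilon>"
        using \<mu> p(3) k commute[of \<nu> p] by (intro bexI[of _ \<mu>]) auto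
    qed
    then have "near p (1 / Suc k) \<in> null_sets m"
      using \<epsilon>(2) near_borel[OF p(2)] null_sets_subset by blast
    moreover have "x \<in> near p (1 / Suc k)"
      using \<nu>(1) p(3) unfolding near_def by blast
    ultimately show "x \<in> (\<Union>k. Z k)"
      unfolding Z_def using p(1) by blast
  next
    fix x assume "x \<in> (\<Union>k. Z k)"
    then obtain k p where p: "p \<in> F k" "near p (1 / Suc k) \<in> null_sets m"
      "x \<in> near p (1 / Suc k)"
      unfolding Z_def by blast
    then obtain \<nu> where \<nu>: "\<nu> \<in> p_omega f x" "d \<nu> p < 1 / Suc k"
      unfolding near_def by blast
    have "\<nu> \<notin> \<O>"
      using not_observable_if_near_null[OF p(2) _ _ \<nu>(2)] F(2) p(1) \<nu>(1) p_omega_subset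
      by blast
    then show "x \<in> - basin f \<O>"
      using \<nu>(1) unfolding basin_def by blast
  qed
  then have "basin f \<O> = space m - (\<Union>k. Z k)"
    using sets_eq_imp_space_eq[OF sets_m] by auto
  then show ?thesis
    using emeasure_Diff_null_set[OF null, of "space m"] prob_space.emeasure_space_1[OF prob_m]
    by simp
qed

lemma observable_subset:
  assumes K: "compactin weak_star K" and basin: "emeasure m (basin f K) = 1"
  shows "\<O> \<subseteq> K"
proof
  fix \<mu> assume \<mu>: "\<mu> \<in> \<O>"
  show "\<mu> \<in> K"
  proof (rule ccontr)
    assume "\<mu> \<notin> K"
    have "\<mu> \<in> P"
      using \<mu> observable_iff by blast
    have "closedin mtopology K"
      using compactin_imp_closedin[OF Hausdorff_space_mtopology] K mtopology by simp
    then obtain \<epsilon> where \<epsilon>: "\<epsilon> > 0" "disjnt K (mball \<mu> \<epsilon>)"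
      using \<open>\<mu> \<in> P\<close> \<open>\<mu> \<notin> K\<close> unfolding closedin_metric by blast
    have "d \<mu> \<nu> \<ge> \<epsilon>" if "\<nu> \<in> K" "\<nu> \<in> P" for \<nu>
      using that \<epsilon>(2) \<open>\<mu> \<in> P\<close> by (auto simp: disjnt_iff not_less)
    then have sub: "near \<mu> \<epsilon> \<subseteq> space m - basin f K"
      using p_omega_subset commute sets_eq_imp_space_eq[OF sets_m]
      unfolding near_def basin_def by fastforce
    \<comment> \<open>Nonmeasurable sets have \<open>emeasure\<close> 0 by convention, so full measure gives measurability.\<close>
    have meas: "basin f K \<in> sets m"
      using basin emeasure_notin_sets by fastforce
    interpret prob_space m by (rule prob_m)
    have "emeasure m (space m - basin f K) = 0"
      using emeasure_compl[OF meas] basin emeasure_space_1 by simp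
    then have "space m - basin f K \<in> null_sets m"
      using meas by (intro null_setsI sets.compl_sets)
    then have "near \<mu> \<epsilon> \<in> null_sets m"
      by (rule null_sets_subset[OF _ near_borel[OF \<open>\<mu> \<in> P\<close>] sub])
    then show False
      using \<mu> \<epsilon>(1) observable_iff by blast
  qed
qed

end

theorem theorem1p5:
  fixes \<A> :: "('a::{second_countable_topology, t2_space}, 'n::finite) chart set"
    and g :: "('a, 'n) chart \<Rightarrow> real ^ 'n \<Rightarrow> real ^ 'n ^ 'n"
    and m :: "'a measure"
    and dist_star :: "'a measure \<Rightarrow> 'a measure \<Rightarrow> real"
    and f :: "'a \<Rightarrow> 'a"
  assumes "compact (UNIV :: 'a set)"
    and "smooth_atlas \<A>"
    and "riemannian_metric \<A> g"
    and "normalized_volume \<A> g m"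
    and "Metric_space borel_probabilities dist_star"
    and "Metric_space.mtopology borel_probabilities dist_star = weak_star"
    and "continuous_on UNIV f"
  shows "compactin weak_star (observable_measures m dist_star f) \<and>
    emeasure m (basin f (observable_measures m dist_star f)) = 1 \<and>
    (\<forall>K. compactin weak_star K \<and> emeasure m (basin f K) = 1 \<longrightarrow>
       observable_measures m dist_star f \<subseteq> K)"
proof -
  have sets_m: "sets m = sets borel"
    using assms(4) by (auto simp: normalized_volume_def riemannian_volume_def)
  have "prob_space m"
    using assms(4) sets_eq_imp_space_eq[OF sets_m]
    by (intro prob_spaceI) (simp add: normalized_volume_def)
  interpret empirical_dynamics dist_star f m
    using assms sets_m \<open>prob_space m\<close>
    by (simp add: empirical_dynamics_def empirical_dynamics_axioms_def)
  show ?thesis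
    using compactin_observable basin_observable observable_subset by blast
qed

end
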